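(* Let $P$ be a dcpo such that: (1) $P$ is bounded-sober; (2) every element $a\in P$ is the supremum of a directed set of down-linear elements of $P$. Then $P$ is $C_{\sigma}$-unique.
   Context: A dcpo (directed complete poset) is a poset in which every directed (in particular nonempty) subset has a supremum. For a poset $P$ and $A\subseteq P$, $\downarrow A=\{x\in P: x\le y\text{ for some }y\in A\}$ and $\downarrow a=\downarrow\{a\}$. A subset $A$ of a dcpo $P$ is Scott closed if $A=\downarrow A$ and $\bigvee D\in A$ for every directed $D\subseteq A$; these are the closed sets of the Scott topology. $C_{\sigma}(P)$ is the lattice of all Scott closed subsets of $P$ (including $\emptyset$), ordered by inclusion. A dcpo $P$ is $C_{\sigma}$-unique if for every dcpo $Q$, whenever the lattices $C_{\sigma}(P)$ and $C_{\sigma}(Q)$ are isomorphic, $P$ and $Q$ are order-isomorphic. A subset $A$ of a topological space is irreducible if whenever $A\subseteq F_1\cup F_2$ with $F_1,F_2$ closed, then $A\subseteq F_1$ or $A\subseteq F_2$. A $T_0$ space is bounded-sober if every nonempty closed irreducible subset that has an upper bound with respect to the specialization order ($x\le y$ iff $x\in cl(\{y\})$) is the closure of a point. A dcpo is called bounded-sober if it is so in its Scott topology (whose specialization order is the original order). An element $a$ of a poset is down-linear if $\downarrow a$ is a chain (any two elements of $\downarrow a$ are comparable). *)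

theory Defs
  imports "HOL-Analysis.Analysis"
begin

text \<open>A poset is a relation \<open>r\<close> with \<open>Partial_order r\<close>; its carrier is \<open>Field r\<close>
  (which may be empty), and \<open>(x, y) \<in> r\<close> means \<open>x \<le> y\<close>.\<close>

definition is_sup :: "'a rel \<Rightarrow> 'a set \<Rightarrow> 'a \<Rightarrow> bool" where
  "is_sup r S x \<longleftrightarrow> x \<in> Above r S \<and> (\<forall>y \<in> Above r S. (x, y) \<in> r)"

definition directed :: "'a rel \<Rightarrow> 'a set \<Rightarrow> bool" where
  "directed r D \<longleftrightarrow> D \<subseteq> Field r \<and> D \<noteq> {} \<and>
     (\<forall>x \<in> D. \<forall>y \<in> D. \<exists>z \<in> D. (x, z) \<in> r \<and> (y, z) \<in> r)"

definition dcpo :: "'a rel \<Rightarrow> bool" where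
  "dcpo r \<longleftrightarrow> Partial_order r \<and> (\<forall>D. directed r D \<longrightarrow> (\<exists>x. is_sup r D x))"

definition down :: "'a rel \<Rightarrow> 'a set \<Rightarrow> 'a set" where
  "down r A = {x \<in> Field r. \<exists>y \<in> A. (x, y) \<in> r}"

definition scott_closed :: "'a rel \<Rightarrow> 'a set \<Rightarrow> bool" where
  "scott_closed r A \<longleftrightarrow> A \<subseteq> Field r \<and> A = down r A \<and>
     (\<forall>D x. directed r D \<and> D \<subseteq> A \<and> is_sup r D x \<longrightarrow> x \<in> A)"

definition order_isomorphic :: "'a rel \<Rightarrow> 'b rel \<Rightarrow> bool" where
  "order_isomorphic r s \<longleftrightarrow>
     (\<exists>f. bij_betw f (Field r) (Field s) \<and>
          (\<forall>x \<in> Field r. \<forall>y \<in> Field r. (x, y) \<in> r \<longleftrightarrow> (f x, f y) \<in> s))"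

definition Csigma :: "'a rel \<Rightarrow> 'a set rel" where
  "Csigma r = relation_of (\<subseteq>) {A. scott_closed r A}"

text \<open>HOL cannot quantify over types inside a formula, so the type from which the dcpos \<open>Q\<close>
  take their elements is a parameter. A theorem \<open>Csigma_unique TYPE('b) r\<close> with \<open>'b\<close> a free
  type variable covers all dcpos \<open>Q\<close>.\<close>

definition Csigma_unique :: "'b itself \<Rightarrow> 'a rel \<Rightarrow> bool" where
  "Csigma_unique _ r \<longleftrightarrow>
     (\<forall>s :: 'b rel. dcpo s \<longrightarrow> order_isomorphic (Csigma r) (Csigma s) \<longrightarrow> order_isomorphic r s)"

definition irreducible_in :: "'a topology \<Rightarrow> 'a set \<Rightarrow> bool" where
  "irreducible_in X A \<longleftrightarrow> A \<subseteq> topspace X \<and>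
     (\<forall>F1 F2. closedin X F1 \<and> closedin X F2 \<and> A \<subseteq> F1 \<union> F2 \<longrightarrow> A \<subseteq> F1 \<or> A \<subseteq> F2)"

definition specialization :: "'a topology \<Rightarrow> 'a rel" where
  "specialization X = {(x, y) \<in> topspace X \<times> topspace X. x \<in> X closure_of {y}}"

definition bounded_sober_space :: "'a topology \<Rightarrow> bool" where
  "bounded_sober_space X \<longleftrightarrow> t0_space X \<and>
     (\<forall>A. A \<noteq> {} \<and> closedin X A \<and> irreducible_in X A \<and> Above (specialization X) A \<noteq> {}
        \<longrightarrow> (\<exists>x \<in> topspace X. A = X closure_of {x}))"

definition scott_topology :: "'a rel \<Rightarrow> 'a topology" where
  "scott_topology r = topology (\<lambda>U. U \<subseteq> Field r \<and> scott_closed r (Field r - U))"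

definition bounded_sober :: "'a rel \<Rightarrow> bool" where
  "bounded_sober r \<longleftrightarrow> bounded_sober_space (scott_topology r)"

definition down_linear :: "'a rel \<Rightarrow> 'a \<Rightarrow> bool" where
  "down_linear r a \<longleftrightarrow> a \<in> Field r \<and> down r {a} \<in> Chains r"

text \<open>\<^const>\<open>scott_topology\<close> is given through \<^const>\<open>topology\<close>, which is meaningful only for
  predicates satisfying \<^const>\<open>istopology\<close>; the following facts verify this and that the
  specialization order is the original order.\<close>

lemma scott_closed_Un:
  assumes "scott_closed r A" "scott_closed r B"
  shows "scott_closed r (A \<union> B)"
proof -
  have A: "A \<subseteq> Field r" "A = down r A" "\<And>D x. directed r D \<Longrightarrow> D \<subseteq> A \<Longrightarrow> is_sup r D x \<Longrightarrow> x \<in> A"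
    and B: "B \<subseteq> Field r" "B = down r B" "\<And>D x. directed r D \<Longrightarrow> D \<subseteq> B \<Longrightarrow> is_sup r D x \<Longrightarrow> x \<in> B"
    using assms unfolding scott_closed_def by blast+
  have "x \<in> A \<union> B" if D: "directed r D" "D \<subseteq> A \<union> B" "is_sup r D x" for D x
  proof -
    have lowA: "u \<in> A" if "v \<in> A" "(u, v) \<in> r" for u v
      using that A(2) unfolding down_def Field_def by blast
    have lowB: "u \<in> B" if "v \<in> B" "(u, v) \<in> r" for u v
      using that B(2) unfolding down_def Field_def by blast
    have "D \<subseteq> A \<or> D \<subseteq> B"
    proof (rule ccontr)
      assume "\<not> (D \<subseteq> A \<or> D \<subseteq> B)"
      then obtain a b where "a \<in> D" "a \<notin> A" "b \<in> D" "b \<notin> B" by blast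
      moreover from this obtain z where "z \<in> D" "(a, z) \<in> r" "(b, z) \<in> r"
        using D(1) unfolding directed_def by blast
      ultimately show False using D(2) lowA lowB by blast
    qed
    then show ?thesis using A(3) B(3) D by blast
  qed
  moreover have "down r (A \<union> B) = down r A \<union> down r B"
    unfolding down_def by blast
  ultimately show ?thesis
    unfolding scott_closed_def using A(1,2) B(1,2) by blast
qed

lemma scott_closed_Inter:
  assumes "\<K> \<noteq> {}" "\<And>A. A \<in> \<K> \<Longrightarrow> scott_closed r A" "Partial_order r"
  shows "scott_closed r (\<Inter>\<K>)"
proof -
  have sub: "\<Inter>\<K> \<subseteq> Field r"
    using assms(1,2) unfolding scott_closed_def by blast
  have "\<Inter>\<K> \<subseteq> down r (\<Inter>\<K>)"
    using sub assms(3) unfolding down_def order_on_defs refl_on_def by blast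
  moreover have "down r (\<Inter>\<K>) \<subseteq> A" if "A \<in> \<K>" for A
  proof -
    have "down r (\<Inter>\<K>) \<subseteq> down r A" using that unfolding down_def by blast
    then show ?thesis using assms(2)[OF that] unfolding scott_closed_def by blast
  qed
  moreover have "x \<in> \<Inter>\<K>" if "directed r D" "D \<subseteq> \<Inter>\<K>" "is_sup r D x" for D x
    using that assms(2) unfolding scott_closed_def by blast
  ultimately show ?thesis using sub unfolding scott_closed_def by blast
qed

lemma scott_closed_empty: "scott_closed r {}"
  by (auto simp: scott_closed_def down_def directed_def)

lemma scott_closed_Field: "Partial_order r \<Longrightarrow> scott_closed r (Field r)"
  unfolding scott_closed_def down_def is_sup_def Above_def order_on_defs refl_on_def by blast

lemma istopology_scott:
  assumes "Partial_order r"
  shows "istopology (\<lambda>U. U \<subseteq> Field r \<and> scott_closed r (Field r - U))"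
  unfolding istopology_def
proof (intro conjI allI impI)
  fix S T assume "S \<subseteq> Field r \<and> scott_closed r (Field r - S)" "T \<subseteq> Field r \<and> scott_closed r (Field r - T)"
  then show "S \<inter> T \<subseteq> Field r" "scott_closed r (Field r - S \<inter> T)"
    using scott_closed_Un by (auto simp: Diff_Int)
next
  fix \<K> assume K: "\<forall>K \<in> \<K>. K \<subseteq> Field r \<and> scott_closed r (Field r - K)"
  then show "\<Union>\<K> \<subseteq> Field r" by blast
  show "scott_closed r (Field r - \<Union>\<K>)"
  proof (cases "\<K> = {}")
    case True
    then show ?thesis using scott_closed_Field[OF assms] by simp
  next
    case False
    then have "Field r - \<Union>\<K> = \<Inter>((-) (Field r) ` \<K>)" by blast
    then show ?thesis
      using scott_closed_Inter[of "(-) (Field r) ` \<K>" r] False K assms by auto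
  qed
qed

lemma openin_scott_topology:
  assumes "Partial_order r"
  shows "openin (scott_topology r) U \<longleftrightarrow> U \<subseteq> Field r \<and> scott_closed r (Field r - U)"
  using topology_inverse'[OF istopology_scott[OF assms]] unfolding scott_topology_def by simp

lemma topspace_scott_topology:
  assumes "Partial_order r"
  shows "topspace (scott_topology r) = Field r"
  unfolding topspace_def using openin_scott_topology[OF assms] scott_closed_empty[of r]
  by (auto intro!: exI[of _ "Field r"])

lemma closedin_scott_topology:
  assumes "Partial_order r"
  shows "closedin (scott_topology r) A \<longleftrightarrow> scott_closed r A"
  using assms unfolding closedin_def openin_scott_topology[OF assms] topspace_scott_topology[OF assms]
  by (auto simp: double_diff scott_closed_def)

lemma Field_Csigma: "Field (Csigma r) = {A. scott_closed r A}"
  by (auto simp: Csigma_def relation_of_def Field_def)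

lemma specialization_scott_topology:
  assumes "Partial_order r"
  shows "specialization (scott_topology r) = r"
proof -
  have "scott_topology r closure_of {y} = down r {y}" if y: "y \<in> Field r" for y
  proof (rule closure_of_unique)
    have "down r {y} = down r (down r {y})"
      using assms unfolding down_def order_on_defs refl_on_def trans_def by blast
    moreover have "x \<in> down r {y}" if "D \<subseteq> down r {y}" "is_sup r D x" for D x
      using that y unfolding down_def is_sup_def Above_def by blast
    ultimately show "closedin (scott_topology r) (down r {y})"
      unfolding closedin_scott_topology[OF assms] scott_closed_def down_def[of r "{y}"] by blast
  next
    show "{y} \<subseteq> down r {y}"
      using y assms unfolding down_def order_on_defs refl_on_def by blast
  next
    fix T assume "{y} \<subseteq> T" "closedin (scott_topology r) T"
    then show "down r {y} \<subseteq> T"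
      unfolding closedin_scott_topology[OF assms] scott_closed_def down_def by blast
  qed
  then show ?thesis
    unfolding specialization_def topspace_scott_topology[OF assms]
    by (auto simp: down_def intro: FieldI1 FieldI2)
qed

end

theory Submission
  imports Defs
begin

text \<open>
  Let \<open>\<phi>\<close> be an isomorphism from the lattice of Scott closed sets of a dcpo \<open>P\<close> satisfying the
  hypotheses onto that of a dcpo \<open>Q\<close>. The proof shows that \<open>\<phi>\<close> restricts to a bijection between
  the principal ideals of \<open>P\<close> and those of \<open>Q\<close>; as \<open>x \<le> y\<close> iff \<open>\<down>x \<subseteq> \<down>y\<close>, this is an order
  isomorphism from \<open>P\<close> to \<open>Q\<close>.

  \<^item> If \<open>x\<close> is down-linear, then the Scott closed subsets of \<open>\<down>x\<close> form a chain under inclusion.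
    So do those of \<open>\<phi>(\<down>x)\<close>, in particular the principal ideals that it contains. Hence
    \<open>\<phi>(\<down>x)\<close> is a nonempty chain, and being Scott closed it contains its supremum: it is
    principal (lemma \<open>maps_principal_down_linear\<close>).

  \<^item> If \<open>a\<close> is the supremum of a directed set \<open>D\<close>, then \<open>\<down>a\<close> is the join of the \<open>\<down>d\<close>, \<open>d \<in> D\<close>.
    Consequently, if every \<open>\<phi>(\<down>d)\<close> is principal, so is \<open>\<phi>(\<down>a)\<close> (lemma \<open>maps_principal_sup\<close>).
    With the second hypothesis on \<open>P\<close>, \<open>\<phi>(\<down>a)\<close> is principal for every \<open>a\<close>.

  \<^item> It remains to see that every principal ideal of \<open>Q\<close> is reached. Let \<open>M\<close> be the set of
    generators of the ideals \<open>\<phi>(\<down>a)\<close>. It is closed under directed suprema by the second step.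
    It is a lower set: if \<open>z\<close> lies below a generator of \<open>\<phi>(\<down>a)\<close>, then the closed set
    corresponding to \<open>\<down>z\<close> is irreducible and bounded by \<open>a\<close>, hence principal since \<open>P\<close> is
    bounded-sober. So \<open>M\<close> is Scott closed, and the closed subset of \<open>P\<close> that corresponds to it
    contains every \<open>\<down>a\<close>. That subset is therefore all of \<open>P\<close>, and \<open>M\<close> is all of \<open>Q\<close>
    (lemma \<open>principal_preimage\<close>).
\<close>

section \<open>Principal ideals and Scott closed sets\<close>

lemma partial_order_refl: "Partial_order r \<Longrightarrow> x \<in> Field r \<Longrightarrow> (x, x) \<in> r"
  unfolding order_on_defs refl_on_def by blast

lemma partial_order_trans: "Partial_order r \<Longrightarrow> (x, y) \<in> r \<Longrightarrow> (y, z) \<in> r \<Longrightarrow> (x, z) \<in> r"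
  unfolding order_on_defs by (blast dest: transD)

lemma partial_order_antisym: "Partial_order r \<Longrightarrow> (x, y) \<in> r \<Longrightarrow> (y, x) \<in> r \<Longrightarrow> x = y"
  unfolding order_on_defs by (blast dest: antisymD)

lemma mem_down_singleton: "x \<in> down r {y} \<longleftrightarrow> (x, y) \<in> r"
  unfolding down_def by (auto intro: FieldI1)

lemma down_singleton_subset_iff:
  assumes "Partial_order r" "x \<in> Field r"
  shows "down r {x} \<subseteq> down r {y} \<longleftrightarrow> (x, y) \<in> r"
  unfolding subset_iff mem_down_singleton
  using partial_order_refl[OF assms] partial_order_trans[OF assms(1)] by blast

lemma down_singleton_eq_iff:
  assumes "Partial_order r" "x \<in> Field r" "y \<in> Field r"
  shows "down r {x} = down r {y} \<longleftrightarrow> x = y"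
  using down_singleton_subset_iff[OF assms(1,2), of y] down_singleton_subset_iff[OF assms(1,3), of x]
    partial_order_antisym[OF assms(1), of x y] by blast

lemma scott_closed_lower: "scott_closed r A \<Longrightarrow> y \<in> A \<Longrightarrow> (x, y) \<in> r \<Longrightarrow> x \<in> A"
  unfolding scott_closed_def down_def by (blast intro: FieldI1)

lemma scott_closed_subset_Field: "scott_closed r A \<Longrightarrow> A \<subseteq> Field r"
  unfolding scott_closed_def by blast

lemma scott_closed_sup:
  "scott_closed r A \<Longrightarrow> directed r D \<Longrightarrow> D \<subseteq> A \<Longrightarrow> is_sup r D x \<Longrightarrow> x \<in> A"
  unfolding scott_closed_def by blast

lemma scott_closedI:
  assumes "Partial_order r" "A \<subseteq> Field r"
    and "\<And>x y. y \<in> A \<Longrightarrow> (x, y) \<in> r \<Longrightarrow> x \<in> A"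
    and "\<And>D x. directed r D \<Longrightarrow> D \<subseteq> A \<Longrightarrow> is_sup r D x \<Longrightarrow> x \<in> A"
  shows "scott_closed r A"
proof -
  have "A = down r A"
    using assms(2,3) partial_order_refl[OF assms(1)] unfolding down_def by blast
  then show ?thesis
    using assms(2,4) unfolding scott_closed_def by blast
qed

lemma is_sup_upper: "is_sup r S x \<Longrightarrow> y \<in> S \<Longrightarrow> (y, x) \<in> r"
  unfolding is_sup_def Above_def by blast

lemma is_sup_least: "is_sup r S x \<Longrightarrow> y \<in> Field r \<Longrightarrow> (\<And>z. z \<in> S \<Longrightarrow> (z, y) \<in> r) \<Longrightarrow> (x, y) \<in> r"
  unfolding is_sup_def Above_def by blast

lemma is_sup_Field: "is_sup r S x \<Longrightarrow> x \<in> Field r"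
  unfolding is_sup_def Above_def by blast

lemma scott_closed_down_singleton:
  assumes "Partial_order r" "y \<in> Field r"
  shows "scott_closed r (down r {y})"
proof (rule scott_closedI[OF assms(1)])
  show "down r {y} \<subseteq> Field r"
    unfolding down_def by blast
next
  fix u v assume "v \<in> down r {y}" "(u, v) \<in> r"
  then show "u \<in> down r {y}"
    unfolding mem_down_singleton using partial_order_trans[OF assms(1)] by blast
next
  fix D x assume D: "D \<subseteq> down r {y}" "is_sup r D x"
  have "(z, y) \<in> r" if "z \<in> D" for z
    using D(1) that mem_down_singleton[of z r y] by blast
  then show "x \<in> down r {y}"
    unfolding mem_down_singleton by (rule is_sup_least[OF D(2) assms(2)])
qed

lemma down_singleton_subset_closed_iff:
  assumes "Partial_order r" "scott_closed r A" "x \<in> Field r"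
  shows "down r {x} \<subseteq> A \<longleftrightarrow> x \<in> A"
  unfolding subset_iff mem_down_singleton
  using scott_closed_lower[OF assms(2)] partial_order_refl[OF assms(1,3)] by blast

lemma scott_closed_chain_principal:
  assumes "dcpo r" "scott_closed r A" "A \<noteq> {}" "A \<in> Chains r"
  obtains x where "x \<in> Field r" "A = down r {x}"
proof -
  have po: "Partial_order r"
    using assms(1) unfolding dcpo_def by blast
  have AF: "A \<subseteq> Field r"
    by (rule scott_closed_subset_Field[OF assms(2)])
  have dir: "directed r A"
    using assms(3,4) AF partial_order_refl[OF po] unfolding directed_def Chains_def by blast
  then obtain x where x: "is_sup r A x"
    using assms(1) unfolding dcpo_def by blast
  have "x \<in> A"
    by (rule scott_closed_sup[OF assms(2) dir subset_refl x])
  then have "A = down r {x}"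
    unfolding set_eq_iff mem_down_singleton
    using is_sup_upper[OF x] scott_closed_lower[OF assms(2)] by blast
  then show thesis
    using that is_sup_Field[OF x] by blast
qed

text \<open>Bounded-sobriety in purely order-theoretic terms: the closed sets of the Scott topology are the
  Scott closed sets, its specialization order is the given order, and so the closure of a point is
  the principal ideal it generates.\<close>

lemma bounded_sober_principal:
  assumes "Partial_order r" "bounded_sober r" "scott_closed r A" "A \<noteq> {}"
    and irr: "\<And>F G. scott_closed r F \<Longrightarrow> scott_closed r G \<Longrightarrow> A \<subseteq> F \<union> G \<Longrightarrow> A \<subseteq> F \<or> A \<subseteq> G"
    and u: "u \<in> Field r" "\<And>x. x \<in> A \<Longrightarrow> (x, u) \<in> r"
  obtains x where "x \<in> Field r" "A = down r {x}"
proof -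
  let ?X = "scott_topology r"
  have "irreducible_in ?X A"
    using irr scott_closed_subset_Field[OF assms(3)]
    unfolding irreducible_in_def closedin_scott_topology[OF assms(1)]
      topspace_scott_topology[OF assms(1)] by blast
  moreover have "Above (specialization ?X) A \<noteq> {}"
    using u unfolding specialization_scott_topology[OF assms(1)] Above_def by blast
  moreover have "closedin ?X A"
    using assms(3) closedin_scott_topology[OF assms(1)] by blast
  ultimately obtain x where x: "x \<in> Field r" "A = ?X closure_of {x}"
    using assms(2,4) topspace_scott_topology[OF assms(1)]
    unfolding bounded_sober_def bounded_sober_space_def by blast
  have "y \<in> ?X closure_of {x} \<longleftrightarrow> (y, x) \<in> specialization ?X" for y
    using x(1) closure_of_subset_topspace[of ?X "{x}"] topspace_scott_topology[OF assms(1)]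
    unfolding specialization_def by auto
  then have "A = down r {x}"
    using x(2) specialization_scott_topology[OF assms(1)] by (auto simp: mem_down_singleton)
  then show thesis
    using that x(1) by blast
qed

section \<open>Isomorphisms between lattices of Scott closed sets\<close>

locale scott_closed_iso =
  fixes r :: "'a rel" and s :: "'b rel" and \<phi> :: "'a set \<Rightarrow> 'b set"
  assumes dcpo_r: "dcpo r" and dcpo_s: "dcpo s"
    and bij: "bij_betw \<phi> {A. scott_closed r A} {B. scott_closed s B}"
    and mono_iff: "\<And>A B. scott_closed r A \<Longrightarrow> scott_closed r B \<Longrightarrow> \<phi> A \<subseteq> \<phi> B \<longleftrightarrow> A \<subseteq> B"
begin

lemma po_r: "Partial_order r" and po_s: "Partial_order s"
  using dcpo_r dcpo_s unfolding dcpo_def by blast+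

lemma closed_image: "scott_closed r A \<Longrightarrow> scott_closed s (\<phi> A)"
  using bij unfolding bij_betw_def by blast

lemma closed_preimage:
  assumes "scott_closed s B"
  obtains A where "scott_closed r A" "\<phi> A = B"
proof -
  have "B \<in> \<phi> ` {A. scott_closed r A}"
    using bij assms unfolding bij_betw_def by simp
  then show thesis
    using that by blast
qed

lemma image_empty: "\<phi> {} = {}"
proof -
  obtain A where A: "scott_closed r A" "\<phi> A = {}"
    using closed_preimage[OF scott_closed_empty] by blast
  have "\<phi> {} \<subseteq> \<phi> A"
    using mono_iff[OF scott_closed_empty A(1)] by blast
  then show ?thesis
    using A(2) by blast
qed

lemma image_Un_subset:
  assumes "scott_closed r A" "scott_closed r B"
  shows "\<phi> (A \<union> B) \<subseteq> \<phi> A \<union> \<phi> B"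
proof -
  obtain C where C: "scott_closed r C" "\<phi> C = \<phi> A \<union> \<phi> B"
    using closed_preimage[OF scott_closed_Un[OF closed_image closed_image]] assms by metis
  have "A \<subseteq> C" "B \<subseteq> C"
    using mono_iff C assms by blast+
  then have "\<phi> (A \<union> B) \<subseteq> \<phi> C"
    using mono_iff[OF scott_closed_Un[OF assms] C(1)] by blast
  then show ?thesis
    using C(2) by blast
qed

text \<open>This relation will turn out to be the graph of an order isomorphism. A relation is used
  because it treats the two directions of \<open>\<phi>\<close> alike while totality and surjectivity are still to be
  established.\<close>

definition maps_principal :: "'a \<Rightarrow> 'b \<Rightarrow> bool" where
  "maps_principal x y \<longleftrightarrow> x \<in> Field r \<and> y \<in> Field s \<and> \<phi> (down r {x}) = down s {y}"

lemma maps_principalD: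
  assumes "maps_principal x y"
  shows "x \<in> Field r" "y \<in> Field s" "\<phi> (down r {x}) = down s {y}"
  using assms unfolding maps_principal_def by simp_all

lemma maps_principal_order_iff:
  assumes "maps_principal x y" "maps_principal x' y'"
  shows "(x, x') \<in> r \<longleftrightarrow> (y, y') \<in> s"
proof -
  have "(x, x') \<in> r \<longleftrightarrow> down r {x} \<subseteq> down r {x'}"
    using down_singleton_subset_iff[OF po_r maps_principalD(1)[OF assms(1)]] by blast
  also have "\<dots> \<longleftrightarrow> down s {y} \<subseteq> down s {y'}"
    using mono_iff[of "down r {x}" "down r {x'}"] scott_closed_down_singleton[OF po_r] assms
    unfolding maps_principal_def by simp
  also have "\<dots> \<longleftrightarrow> (y, y') \<in> s"
    using down_singleton_subset_iff[OF po_s maps_principalD(2)[OF assms(1)]] by blast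
  finally show ?thesis .
qed

text \<open>Lower subsets of a chain are comparable, and this comparability carries over to the principal
  ideals inside the image.\<close>

lemma maps_principal_down_linear:
  assumes "down_linear r x"
  obtains y where "maps_principal x y"
proof -
  let ?F = "\<phi> (down r {x})"
  have x: "x \<in> Field r" and chain: "down r {x} \<in> Chains r"
    using assms unfolding down_linear_def by blast+
  have xC: "scott_closed r (down r {x})"
    by (rule scott_closed_down_singleton[OF po_r x])
  have FC: "scott_closed s ?F"
    by (rule closed_image[OF xC])
  have "x \<in> down r {x}"
    unfolding mem_down_singleton by (rule partial_order_refl[OF po_r x])
  then have "\<not> ?F \<subseteq> \<phi> {}"
    using mono_iff[OF xC scott_closed_empty] by blast
  then have ne: "?F \<noteq> {}"
    by blast
  have "(y, z) \<in> s \<or> (z, y) \<in> s" if y: "y \<in> ?F" and z: "z \<in> ?F" for y z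
  proof -
    have yF: "y \<in> Field s" and zF: "z \<in> Field s"
      using y z scott_closed_subset_Field[OF FC] by blast+
    obtain A where A: "scott_closed r A" "\<phi> A = down s {y}"
      using closed_preimage[OF scott_closed_down_singleton[OF po_s yF]] by blast
    obtain B where B: "scott_closed r B" "\<phi> B = down s {z}"
      using closed_preimage[OF scott_closed_down_singleton[OF po_s zF]] by blast
    have "\<phi> A \<subseteq> ?F" "\<phi> B \<subseteq> ?F"
      unfolding A(2) B(2) using down_singleton_subset_closed_iff[OF po_s FC] y z yF zF by blast+
    then have "A \<subseteq> down r {x}" "B \<subseteq> down r {x}"
      using mono_iff[OF A(1) xC] mono_iff[OF B(1) xC] by blast+
    then have "A \<subseteq> B \<or> B \<subseteq> A"
      using chain scott_closed_lower[OF A(1)] scott_closed_lower[OF B(1)]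
      unfolding Chains_def by blast
    then have "\<phi> A \<subseteq> \<phi> B \<or> \<phi> B \<subseteq> \<phi> A"
      using mono_iff A(1) B(1) by blast
    then show ?thesis
      unfolding A(2) B(2) using down_singleton_subset_iff[OF po_s] yF zF by blast
  qed
  then have "?F \<in> Chains s"
    unfolding Chains_def by blast
  then obtain y where "y \<in> Field s" "?F = down s {y}"
    using scott_closed_chain_principal[OF dcpo_s FC ne] by blast
  then show thesis
    using that x unfolding maps_principal_def by blast
qed

text \<open>The ideal generated by a directed supremum is the least Scott closed set containing the directed
  set, that is, the join of the ideals generated by its members; \<open>\<phi>\<close> and its inverse preserve joins.
  Starting from a directed set in the codomain, as here, covers both uses: suprema of directed sets of
  down-linear elements, and closedness of the set of generators that are reached.\<close>

lemma maps_principal_sup: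
  assumes E: "directed s E" "is_sup s E b"
    and D: "\<And>y. y \<in> E \<Longrightarrow> \<exists>x \<in> D. maps_principal x y"
      "\<And>x. x \<in> D \<Longrightarrow> \<exists>y \<in> E. maps_principal x y"
  obtains a where "is_sup r D a" "maps_principal a b"
proof -
  have DF: "D \<subseteq> Field r"
    using D(2) maps_principalD(1) by blast
  have "directed r D"
    unfolding directed_def
  proof (intro conjI ballI)
    show "D \<subseteq> Field r" by (rule DF)
    show "D \<noteq> {}"
      using E(1) D(1) unfolding directed_def by blast
  next
    fix x x' assume "x \<in> D" "x' \<in> D"
    then obtain y y' where y: "y \<in> E" "maps_principal x y" "y' \<in> E" "maps_principal x' y'"
      using D(2) by meson
    then obtain w where w: "w \<in> E" "(y, w) \<in> s" "(y', w) \<in> s"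
      using E(1) unfolding directed_def by meson
    then obtain v where "v \<in> D" "maps_principal v w"
      using D(1) by blast
    then show "\<exists>z \<in> D. (x, z) \<in> r \<and> (x', z) \<in> r"
      using maps_principal_order_iff y w by blast
  qed
  then obtain a where a: "is_sup r D a"
    using dcpo_r unfolding dcpo_def by blast
  have aF: "a \<in> Field r" and bF: "b \<in> Field s"
    using is_sup_Field a E(2) by metis+
  have aC: "scott_closed r (down r {a})" and bC: "scott_closed s (down s {b})"
    using scott_closed_down_singleton po_r po_s aF bF by metis+
  have "y \<in> \<phi> (down r {a})" if y: "y \<in> E" for y
  proof -
    obtain x where x: "x \<in> D" "maps_principal x y"
      using D(1)[OF y] by blast
    have "down r {x} \<subseteq> down r {a}"
      using down_singleton_subset_iff[OF po_r maps_principalD(1)[OF x(2)]]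
        is_sup_upper[OF a x(1)] by blast
    then have "\<phi> (down r {x}) \<subseteq> \<phi> (down r {a})"
      using mono_iff[OF scott_closed_down_singleton[OF po_r maps_principalD(1)[OF x(2)]] aC]
      by blast
    then show ?thesis
      unfolding maps_principalD(3)[OF x(2)]
      using down_singleton_subset_closed_iff[OF po_s closed_image[OF aC] maps_principalD(2)[OF x(2)]]
      by blast
  qed
  then have "b \<in> \<phi> (down r {a})"
    using scott_closed_sup[OF closed_image[OF aC] E(1) _ E(2)] by blast
  then have ba: "down s {b} \<subseteq> \<phi> (down r {a})"
    using down_singleton_subset_closed_iff[OF po_s closed_image[OF aC] bF] by blast
  obtain B where B: "scott_closed r B" "\<phi> B = down s {b}"
    using closed_preimage[OF bC] by blast
  have "x \<in> B" if x: "x \<in> D" for x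
  proof -
    obtain y where y: "y \<in> E" "maps_principal x y"
      using D(2)[OF x] by blast
    have xF: "x \<in> Field r"
      by (rule maps_principalD(1)[OF y(2)])
    have "\<phi> (down r {x}) \<subseteq> \<phi> B"
      unfolding maps_principalD(3)[OF y(2)] B(2)
      using down_singleton_subset_iff[OF po_s maps_principalD(2)[OF y(2)]]
        is_sup_upper[OF E(2) y(1)] by blast
    then show ?thesis
      using mono_iff[OF scott_closed_down_singleton[OF po_r xF] B(1)]
        down_singleton_subset_closed_iff[OF po_r B(1) xF] by blast
  qed
  then have "a \<in> B"
    using scott_closed_sup[OF B(1) \<open>directed r D\<close> _ a] by blast
  then have "\<phi> (down r {a}) \<subseteq> down s {b}"
    unfolding B(2)[symmetric] mono_iff[OF aC B(1)] down_singleton_subset_closed_iff[OF po_r B(1) aF] .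
  with ba have "maps_principal a b"
    using aF bF unfolding maps_principal_def by simp
  with a show thesis
    using that by blast
qed

lemma maps_principal_total:
  assumes "is_sup r D a" "directed r D" "\<And>d. d \<in> D \<Longrightarrow> down_linear r d"
  obtains b where "maps_principal a b"
proof -
  let ?E = "{y. \<exists>x \<in> D. maps_principal x y}"
  have to: "\<exists>y \<in> ?E. maps_principal x y" if x: "x \<in> D" for x
  proof -
    obtain y where "maps_principal x y"
      by (rule maps_principal_down_linear[OF assms(3)[OF x]])
    then show ?thesis
      using x by blast
  qed
  have "directed s ?E"
    unfolding directed_def
  proof (intro conjI ballI)
    show "?E \<subseteq> Field s"
      using maps_principalD(2) by blast
    show "?E \<noteq> {}"
      using to assms(2) unfolding directed_def by blast
  next
    fix y y' assume "y \<in> ?E" "y' \<in> ?E"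
    then obtain x x' where x: "x \<in> D" "maps_principal x y" "x' \<in> D" "maps_principal x' y'"
      by blast
    then obtain v where v: "v \<in> D" "(x, v) \<in> r" "(x', v) \<in> r"
      using assms(2) unfolding directed_def by meson
    then obtain w where "w \<in> ?E" "maps_principal v w"
      using to by blast
    then show "\<exists>z \<in> ?E. (y, z) \<in> s \<and> (y', z) \<in> s"
      using maps_principal_order_iff x v by blast
  qed
  then obtain b where b: "is_sup s ?E b"
    using dcpo_s unfolding dcpo_def by blast
  obtain a' where a': "is_sup r D a'" "maps_principal a' b"
  proof (rule maps_principal_sup[OF \<open>directed s ?E\<close> b])
    show "\<exists>x \<in> D. maps_principal x y" if "y \<in> ?E" for y
      using that by blast
    show "\<exists>y \<in> ?E. maps_principal x y" if "x \<in> D" for x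
      using that by (rule to)
  qed
  have "a' = a"
    using is_sup_least[OF a'(1) is_sup_Field[OF assms(1)] is_sup_upper[OF assms(1)]]
      is_sup_least[OF assms(1) is_sup_Field[OF a'(1)] is_sup_upper[OF a'(1)]]
    by (blast intro: partial_order_antisym[OF po_r])
  with a'(2) show thesis
    using that by blast
qed

text \<open>A closed set corresponding to a principal ideal is irreducible, because \<open>\<down>z\<close> lies in any closed
  set containing \<open>z\<close> and \<open>\<phi>\<close> preserves finite unions; boundedness then makes it principal.\<close>

lemma maps_principal_lower:
  assumes "bounded_sober r" "maps_principal a b" "(z, b) \<in> s"
  obtains x where "maps_principal x z"
proof -
  have aF: "a \<in> Field r" and ab: "\<phi> (down r {a}) = down s {b}"
    using maps_principalD[OF assms(2)] by simp_all
  have zF: "z \<in> Field s"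
    using assms(3) by (rule FieldI1)
  obtain A where A: "scott_closed r A" "\<phi> A = down s {z}"
    using closed_preimage[OF scott_closed_down_singleton[OF po_s zF]] by blast
  have z: "z \<in> \<phi> A"
    unfolding A(2) mem_down_singleton by (rule partial_order_refl[OF po_s zF])
  then have ne: "A \<noteq> {}"
    using image_empty by blast
  have "\<phi> A \<subseteq> \<phi> (down r {a})"
    unfolding A(2) ab using down_singleton_subset_iff[OF po_s zF] assms(3) by blast
  then have bound: "A \<subseteq> down r {a}"
    using mono_iff[OF A(1) scott_closed_down_singleton[OF po_r aF]] by blast
  have irr: "A \<subseteq> F \<or> A \<subseteq> G"
    if F: "scott_closed r F" and G: "scott_closed r G" and sub: "A \<subseteq> F \<union> G" for F G
  proof -
    have "\<phi> A \<subseteq> \<phi> F \<union> \<phi> G"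
      using sub mono_iff[OF A(1) scott_closed_Un[OF F G]] image_Un_subset[OF F G] by blast
    then have "z \<in> \<phi> F \<or> z \<in> \<phi> G"
      using z by blast
    then have "\<phi> A \<subseteq> \<phi> F \<or> \<phi> A \<subseteq> \<phi> G"
      unfolding A(2) down_singleton_subset_closed_iff[OF po_s closed_image[OF F] zF]
        down_singleton_subset_closed_iff[OF po_s closed_image[OF G] zF] .
    then show ?thesis
      unfolding mono_iff[OF A(1) F] mono_iff[OF A(1) G] .
  qed
  have le: "(x, a) \<in> r" if "x \<in> A" for x
    using bound that mem_down_singleton[of x r a] by blast
  obtain x where "x \<in> Field r" "A = down r {x}"
  proof (rule bounded_sober_principal[OF po_r assms(1) A(1) ne _ aF])
    show "A \<subseteq> F \<or> A \<subseteq> G" if "scott_closed r F" "scott_closed r G" "A \<subseteq> F \<union> G" for F G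
      using that by (rule irr)
    show "(x, a) \<in> r" if "x \<in> A" for x
      using that by (rule le)
  qed
  then have "maps_principal x z"
    using A(2) zF unfolding maps_principal_def by simp
  then show thesis
    by (rule that)
qed

text \<open>The set of generators that are reached is Scott closed. The closed set corresponding to it
  contains every principal ideal of the domain, so it is the top element of the lattice, which \<open>\<phi>\<close>
  sends to the top element.\<close>

lemma principal_preimage:
  assumes "bounded_sober r" and total: "\<And>a. a \<in> Field r \<Longrightarrow> \<exists>b. maps_principal a b"
    and y: "y \<in> Field s"
  obtains x where "maps_principal x y"
proof -
  let ?M = "{y. \<exists>x. maps_principal x y}"
  have "scott_closed s ?M"
  proof (rule scott_closedI[OF po_s])
    show "?M \<subseteq> Field s"
      using maps_principalD(2) by blast
  next
    fix z b assume "b \<in> ?M" and zb: "(z, b) \<in> s"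
    then obtain a where "maps_principal a b"
      by blast
    then obtain x where "maps_principal x z"
      by (rule maps_principal_lower[OF assms(1) _ zb])
    then show "z \<in> ?M"
      by blast
  next
    fix E b assume E: "directed s E" "E \<subseteq> ?M" "is_sup s E b"
    obtain a where "maps_principal a b"
    proof (rule maps_principal_sup[OF E(1,3)])
      let ?D = "{x. \<exists>y \<in> E. maps_principal x y}"
      show "\<exists>x \<in> ?D. maps_principal x y" if "y \<in> E" for y
        using E(2) that by blast
      show "\<exists>y \<in> E. maps_principal x y" if "x \<in> ?D" for x
        using that by blast
    qed
    then show "b \<in> ?M"
      by blast
  qed
  then obtain A where A: "scott_closed r A" "\<phi> A = ?M"
    using closed_preimage by blast
  have "a \<in> A" if a: "a \<in> Field r" for a
  proof -
    obtain b where b: "maps_principal a b"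
      using total a by blast
    then have "down s {b} \<subseteq> ?M"
      using down_singleton_subset_closed_iff[OF po_s \<open>scott_closed s ?M\<close> maps_principalD(2)[OF b]]
      by blast
    then have "\<phi> (down r {a}) \<subseteq> \<phi> A"
      unfolding maps_principalD(3)[OF b] A(2) .
    then show ?thesis
      using mono_iff[OF scott_closed_down_singleton[OF po_r a] A(1)]
        down_singleton_subset_closed_iff[OF po_r A(1) a] by blast
  qed
  then have "Field r \<subseteq> A"
    by blast
  moreover obtain B where B: "scott_closed r B" "\<phi> B = Field s"
    using closed_preimage[OF scott_closed_Field[OF po_s]] by blast
  ultimately have "B \<subseteq> A"
    using scott_closed_subset_Field[OF B(1)] by blast
  then have "Field s \<subseteq> ?M"
    unfolding A(2)[symmetric] B(2)[symmetric] mono_iff[OF B(1) A(1)] .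
  then show thesis
    using that y by blast
qed

lemma order_isomorphic_if_principal:
  assumes "\<And>a. a \<in> Field r \<Longrightarrow> \<exists>b. maps_principal a b"
    and "\<And>b. b \<in> Field s \<Longrightarrow> \<exists>a. maps_principal a b"
  shows "order_isomorphic r s"
proof -
  obtain f where f: "\<And>a. a \<in> Field r \<Longrightarrow> maps_principal a (f a)"
    using assms(1) by metis
  have ord: "(x, y) \<in> r \<longleftrightarrow> (f x, f y) \<in> s" if "x \<in> Field r" "y \<in> Field r" for x y
    using maps_principal_order_iff f that by blast
  have "inj_on f (Field r)"
  proof (rule inj_onI)
    fix x y assume xy: "x \<in> Field r" "y \<in> Field r" "f x = f y"
    have "(f x, f x) \<in> s"
      by (rule partial_order_refl[OF po_s maps_principalD(2)[OF f[OF xy(1)]]])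
    then have "(x, y) \<in> r" "(y, x) \<in> r"
      using ord xy by auto
    then show "x = y"
      by (rule partial_order_antisym[OF po_r])
  qed
  moreover have "f ` Field r = Field s"
  proof
    show "f ` Field r \<subseteq> Field s"
      using maps_principalD(2)[OF f] by blast
    show "Field s \<subseteq> f ` Field r"
    proof
      fix b assume "b \<in> Field s"
      then obtain a where a: "maps_principal a b"
        using assms(2) by blast
      then have aF: "a \<in> Field r"
        by (rule maps_principalD)
      have "b = f a"
        using down_singleton_eq_iff[OF po_s maps_principalD(2)[OF a] maps_principalD(2)[OF f[OF aF]]]
          maps_principalD(3)[OF a] maps_principalD(3)[OF f[OF aF]] by simp
      then show "b \<in> f ` Field r"
        using aF by blast
    qed
  qed
  ultimately show ?thesis
    using ord unfolding order_isomorphic_def bij_betw_def by blast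
qed

end

section \<open>Uniqueness\<close>

theorem corollary3p10:
  fixes r :: "'a rel"
  assumes "dcpo r"
    and "bounded_sober r"
    and "\<forall>a \<in> Field r. \<exists>D. directed r D \<and> (\<forall>d \<in> D. down_linear r d) \<and> is_sup r D a"
  shows "Csigma_unique TYPE('b) r"
  unfolding Csigma_unique_def
proof (intro allI impI)
  fix s :: "'b rel"
  assume s: "dcpo s" and iso: "order_isomorphic (Csigma r) (Csigma s)"
  obtain \<phi> where bij: "bij_betw \<phi> {A. scott_closed r A} {B. scott_closed s B}"
    and ord: "\<And>A B. scott_closed r A \<Longrightarrow> scott_closed r B \<Longrightarrow>
      (A, B) \<in> Csigma r \<longleftrightarrow> (\<phi> A, \<phi> B) \<in> Csigma s"
    using iso unfolding order_isomorphic_def Field_Csigma by blast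
  have "\<phi> A \<subseteq> \<phi> B \<longleftrightarrow> A \<subseteq> B" if "scott_closed r A" "scott_closed r B" for A B
    using ord[OF that] that bij_betwE[OF bij] unfolding Csigma_def relation_of_def by auto
  then interpret scott_closed_iso r s \<phi>
    by unfold_locales (use assms(1) s bij in auto)
  have total: "\<exists>b. maps_principal a b" if "a \<in> Field r" for a
    using assms(3) that maps_principal_total by meson
  have "\<exists>a. maps_principal a b" if "b \<in> Field s" for b
    using principal_preimage[OF assms(2) total that] by blast
  with total show "order_isomorphic r s"
    by (rule order_isomorphic_if_principal)
qed

end
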